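(* Let $n\ge 3$ be an integer and let $r$ be a real number with $n-2\le r<n-1$. Then there is a $\mathbb{Z}/2$-equivariant homeomorphism $\Phi:M_{n,r}\to S^{n-3}$, where the generator of $\mathbb{Z}/2$ acts on $M_{n,r}$ by reflection across the $x$-axis, $(\mathbf{x}_1,\ldots,\mathbf{x}_{n-2})\mapsto(\rho(\mathbf{x}_1),\ldots,\rho(\mathbf{x}_{n-2}))$ with $\rho(x,y)=(x,-y)$, and acts on the sphere $S^{n-3}$ by the antipodal map $v\mapsto -v$.
   Context: Let $d$ denote Euclidean distance in the plane $\mathbb{R}^2$. Fix $\mathbf{x}_0=(0,0)$ and $\mathbf{x}_{n-1}=(r,0)$. Define $$M_{n,r}=\{(\mathbf{x}_1,\ldots,\mathbf{x}_{n-2})\in(\mathbb{R}^2)^{n-2}: d(\mathbf{x}_{i-1},\mathbf{x}_i)=1 \text{ for all } 1\le i\le n-1\},$$ with the subspace topology from $(\mathbb{R}^2)^{n-2}$. This is the moduli space of oriented $n$-gons in the plane (sides are allowed to intersect) with one side of length $r$ and the remaining $n-1$ sides of length $1$, modulo orientation-preserving isometries of the plane; each such polygon is uniquely normalized so that its side of length $r$ is oriented in the negative $x$-direction, going from $(r,0)$ to $(0,0)$. $S^{n-3}$ denotes the unit sphere in $\mathbb{R}^{n-2}$ (so $S^0=\{\pm1\}$). *)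

theory Defs
  imports "HOL-Analysis.Analysis"
begin

text \<open>
  The plane is the type \<^typ>\<open>real \<times> real\<close>, whose \<^const>\<open>dist\<close> is the Euclidean distance.
  A point of $(\mathbb{R}^2)^{n-2}$ is an extensional function on the index set
  \<open>{1..n - 2}\<close>; the sphere $S^k$ is the library's \<^term>\<open>nsphere k\<close>, living in functions
  \<^typ>\<open>nat \<Rightarrow> real\<close> supported on \<open>{..k}\<close>.
\<close>

definition vertex :: "nat \<Rightarrow> real \<Rightarrow> (nat \<Rightarrow> real \<times> real) \<Rightarrow> nat \<Rightarrow> real \<times> real" where
  "vertex n r x i = (if i = 0 then (0, 0) else if i = n - 1 then (r, 0) else x i)"

definition polygon_configs :: "nat \<Rightarrow> real \<Rightarrow> (nat \<Rightarrow> real \<times> real) set" where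
  "polygon_configs n r =
     {x \<in> {1..n - 2} \<rightarrow>\<^sub>E UNIV. \<forall>i\<in>{1..n - 1}. dist (vertex n r x (i - 1)) (vertex n r x i) = 1}"

definition polygon_space :: "nat \<Rightarrow> real \<Rightarrow> (nat \<Rightarrow> real \<times> real) topology" where
  "polygon_space n r =
     subtopology (product_topology (\<lambda>_. euclidean) {1..n - 2}) (polygon_configs n r)"

definition reflect_x :: "real \<times> real \<Rightarrow> real \<times> real" where
  "reflect_x p = (fst p, - snd p)"

text \<open>The restriction keeps the reflected configuration extensional.\<close>

definition reflect_config :: "nat \<Rightarrow> (nat \<Rightarrow> real \<times> real) \<Rightarrow> nat \<Rightarrow> real \<times> real" where
  "reflect_config n x = (\<lambda>i\<in>{1..n - 2}. reflect_x (x i))"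

definition antipode :: "(nat \<Rightarrow> real) \<Rightarrow> nat \<Rightarrow> real" where
  "antipode v = (\<lambda>i. - v i)"

lemma topspace_polygon_space: "topspace (polygon_space n r) = polygon_configs n r"
  by (auto simp: polygon_space_def polygon_configs_def)

lemma dist_reflect_x [simp]: "dist (reflect_x p) (reflect_x q) = dist p q"
  by (simp add: reflect_x_def dist_prod_def dist_real_def abs_minus_commute)

lemma vertex_reflect_config:
  assumes "i \<in> {0..n - 1}"
  shows "vertex n r (reflect_config n x) i = reflect_x (vertex n r x i)"
  using assms by (auto simp: vertex_def reflect_config_def reflect_x_def)

text \<open>Both maps are involutions of the respective spaces, so they define \<open>\<int>/2\<close>-actions.\<close>

lemma reflect_config_in_polygon_space:
  assumes "x \<in> topspace (polygon_space n r)"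
  shows "reflect_config n x \<in> topspace (polygon_space n r)"
proof -
  have "reflect_config n x \<in> {1..n - 2} \<rightarrow>\<^sub>E UNIV"
    by (auto simp: reflect_config_def)
  moreover have "dist (vertex n r (reflect_config n x) (i - 1)) (vertex n r (reflect_config n x) i) = 1"
    if "i \<in> {1..n - 1}" for i
  proof -
    have "i - 1 \<in> {0..n - 1}" "i \<in> {0..n - 1}" using that by auto
    then show ?thesis
      using assms that
      by (simp add: vertex_reflect_config topspace_polygon_space polygon_configs_def)
  qed
  ultimately show ?thesis
    by (simp add: topspace_polygon_space polygon_configs_def)
qed

lemma reflect_config_involution:
  assumes "x \<in> topspace (polygon_space n r)"
  shows "reflect_config n (reflect_config n x) = x"
  using assms
  by (auto simp: topspace_polygon_space polygon_configs_def reflect_config_def reflect_x_def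
      fun_eq_iff PiE_def extensional_def)

lemma antipode_in_nsphere:
  assumes "v \<in> topspace (nsphere k)"
  shows "antipode v \<in> topspace (nsphere k)"
  using assms by (auto simp: nsphere antipode_def)

lemma antipode_involution: "antipode (antipode v) = v"
  by (simp add: antipode_def)

end

theory Submission
  imports Defs
begin

text \<open>
  Let \<open>(c\<^sub>i, s\<^sub>i)\<close> be the \<open>n - 1\<close> unit edge vectors.  Their first coordinates are at most \<open>1\<close> and add
  up to \<open>r \<ge> n - 2\<close>, so each is nonnegative and \<open>c\<^sub>i = sqrt (1 - s\<^sub>i\<^sup>2)\<close>.  A polygon is therefore
  determined by the heights of its vertices, subject to the single equation
  \<open>\<Sum>i. sqrt (1 - s\<^sub>i\<^sup>2) = r\<close>.  Along a ray from the origin in the space of heights, the left-hand side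
  decreases strictly from \<open>n - 1 > r\<close> to a value \<open>\<le> n - 2 \<le> r\<close>, reached when some \<open>\<bar>s\<^sub>i\<bar> = 1\<close>.  Hence each ray
  meets the solution set exactly once, and normalizing the vector of heights gives the homeomorphism;
  the reflection negates heights.
\<close>

section \<open>The level sets of a sum of circular arcs\<close>

text \<open>Termwise comparison: \<open>sqrt\<close> is strictly increasing on all reals, being
  extended as an odd function, so terms with \<open>s i \<noteq> 0\<close> drop strictly, even past
  the point where a radicand turns negative.\<close>

lemma sum_sqrt_strict_decreasing:
  fixes s :: "'a \<Rightarrow> real"
  assumes "finite A" and "\<exists>i\<in>A. s i \<noteq> 0" and "0 \<le> t" and "t < u"
  shows "(\<Sum>i\<in>A. sqrt (1 - (u * s i)\<^sup>2)) < (\<Sum>i\<in>A. sqrt (1 - (t * s i)\<^sup>2))"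
proof (rule sum_strict_mono_ex1)
  have "t\<^sup>2 < u\<^sup>2"
    using assms by (simp add: power_strict_mono)
  then show "\<forall>i\<in>A. sqrt (1 - (u * s i)\<^sup>2) \<le> sqrt (1 - (t * s i)\<^sup>2)"
    and "\<exists>i\<in>A. sqrt (1 - (u * s i)\<^sup>2) < sqrt (1 - (t * s i)\<^sup>2)"
    using assms(2) by (auto simp: power_mult_distrib mult_right_mono intro!: mult_strict_right_mono)
qed (fact assms(1))

text \<open>Intermediate value theorem on \<open>{0..1 / M}\<close>: at \<open>1 / M\<close> the
  term of an index with maximal \<open>\<bar>s i\<bar>\<close> vanishes and every other term is at
  most 1.\<close>

lemma sum_sqrt_attains:
  fixes s :: "'a \<Rightarrow> real"
  assumes A: "finite A" and s: "\<exists>i\<in>A. s i \<noteq> 0"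
    and r: "real (card A) - 1 \<le> r" "r \<le> real (card A)"
  obtains t where "t \<ge> 0" "\<And>i. i \<in> A \<Longrightarrow> \<bar>t * s i\<bar> \<le> 1" "(\<Sum>i\<in>A. sqrt (1 - (t * s i)\<^sup>2)) = r"
proof -
  define M where "M = Max ((\<lambda>i. \<bar>s i\<bar>) ` A)"
  have "A \<noteq> {}"
    using s by auto
  have le_M: "\<bar>s i\<bar> \<le> M" if "i \<in> A" for i
    using A that by (simp add: M_def)
  have "M > 0"
    using s le_M by fastforce
  have "M \<in> (\<lambda>i. \<bar>s i\<bar>) ` A"
    unfolding M_def using A \<open>A \<noteq> {}\<close> by (intro Max_in) auto
  then obtain k where k: "k \<in> A" "\<bar>s k\<bar> = M"
    by auto
  let ?g = "\<lambda>t. \<Sum>i\<in>A. sqrt (1 - (t * s i)\<^sup>2)"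
  have "(1 / M * s k)\<^sup>2 = 1"
    using k(2) \<open>M > 0\<close> by (auto simp: power2_eq_1_iff field_simps abs_if split: if_splits)
  then have "?g (1 / M) = (\<Sum>i\<in>A - {k}. sqrt (1 - (1 / M * s i)\<^sup>2))"
    using A k(1) by (simp add: sum.remove)
  also have "\<dots> \<le> (\<Sum>i\<in>A - {k}. 1)"
    by (intro sum_mono) simp
  also have "\<dots> = real (card A) - 1"
    using A k(1) \<open>A \<noteq> {}\<close> by (simp add: card_gt_0_iff Suc_leI)
  finally have "?g (1 / M) \<le> r"
    using r(1) by simp
  moreover have "r \<le> ?g 0"
    using r(2) by simp
  moreover have "continuous_on {0..1 / M} ?g"
    by (intro continuous_intros)
  ultimately obtain t where t: "0 \<le> t" "t \<le> 1 / M" "?g t = r"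
    using IVT2'[of ?g "1 / M" r 0] \<open>M > 0\<close> by auto
  have "\<bar>t * s i\<bar> \<le> 1" if "i \<in> A" for i
  proof -
    have "\<bar>t * s i\<bar> \<le> 1 / M * M"
      unfolding abs_mult using t le_M[OF that] \<open>M > 0\<close> by (intro mult_mono) auto
    then show ?thesis
      using \<open>M > 0\<close> by simp
  qed
  with t show ?thesis
    using that by blast
qed

lemma vanishes_if_differences_vanish:
  fixes f :: "nat \<Rightarrow> real"
  assumes "f 0 = 0" and "\<And>i. i < m \<Longrightarrow> f (Suc i) - f i = 0" and "j \<le> m"
  shows "f j = 0"
  using assms(3)
proof (induction j)
  case (Suc j)
  then show ?case
    using assms(2)[of j] by simp
qed (use assms(1) in simp)

section \<open>Polygons and the heights of their vertices\<close>

definition rise :: "nat \<Rightarrow> real \<Rightarrow> (nat \<Rightarrow> real \<times> real) \<Rightarrow> nat \<Rightarrow> real" where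
  "rise n r x i = snd (vertex n r x (Suc i)) - snd (vertex n r x i)"

lemma dist_prod_eq_1_iff:
  fixes p q :: "real \<times> real"
  shows "dist p q = 1 \<longleftrightarrow> (fst q - fst p)\<^sup>2 + (snd q - snd p)\<^sup>2 = 1"
  by (simp add: dist_prod_def dist_real_def power2_commute)

text \<open>Numbering edges from 0 matches \<open>rise\<close> and the telescoping sums.\<close>

lemma polygon_configs_alt:
  "polygon_configs n r = {x \<in> {1..n - 2} \<rightarrow>\<^sub>E UNIV.
     \<forall>i<n - 1. dist (vertex n r x i) (vertex n r x (Suc i)) = 1}"
proof -
  have "{1..n - 1} = Suc ` {..<n - 1}"
    by (simp add: lessThan_atLeast0 atLeastLessThanSuc_atLeastAtMost)
  then show ?thesis
    by (auto simp: polygon_configs_def)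
qed

lemma vertex_telescope:
  assumes "j \<le> n - 1"
  shows "(\<Sum>i<j. fst (vertex n r x (Suc i)) - fst (vertex n r x i)) = fst (vertex n r x j)"
  using sum_lessThan_telescope[of "\<lambda>i. fst (vertex n r x i)" j] by (simp add: vertex_def)

lemma polygon_configs_iff_rise:
  assumes "n \<ge> 3" and "real n - 2 \<le> r"
  shows "x \<in> polygon_configs n r \<longleftrightarrow> x \<in> {1..n - 2} \<rightarrow>\<^sub>E UNIV \<and>
    (\<forall>i<n - 1. \<bar>rise n r x i\<bar> \<le> 1 \<and>
       fst (vertex n r x (Suc i)) - fst (vertex n r x i) = sqrt (1 - (rise n r x i)\<^sup>2))"
proof -
  define c where "c i = fst (vertex n r x (Suc i)) - fst (vertex n r x i)" for i
  have "dist (vertex n r x i) (vertex n r x (Suc i)) = 1 \<longleftrightarrow> (c i)\<^sup>2 + (rise n r x i)\<^sup>2 = 1" for i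
    by (simp add: dist_prod_eq_1_iff c_def rise_def)
  moreover have "(\<forall>i<n - 1. (c i)\<^sup>2 + (rise n r x i)\<^sup>2 = 1) \<longleftrightarrow>
      (\<forall>i<n - 1. \<bar>rise n r x i\<bar> \<le> 1 \<and> c i = sqrt (1 - (rise n r x i)\<^sup>2))" (is "?L \<longleftrightarrow> ?R")
  proof
    assume unit: ?L
    have c_le: "c i \<le> 1" if "i < n - 1" for i
    proof (rule power2_le_imp_le)
      show "(c i)\<^sup>2 \<le> 1\<^sup>2"
        using unit[rule_format, OF that] zero_le_power2[of "rise n r x i"] unfolding power_one by linarith
    qed simp
    have c_sum: "(\<Sum>i<n - 1. c i) = r"
      using vertex_telescope[of "n - 1" n r x] \<open>n \<ge> 3\<close> by (simp add: c_def vertex_def)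
    have c_nonneg: "0 \<le> c i" if "i < n - 1" for i
    proof -
      have "r = c i + (\<Sum>j\<in>{..<n - 1} - {i}. c j)"
        using that by (simp add: c_sum[symmetric] sum.remove)
      also have "(\<Sum>j\<in>{..<n - 1} - {i}. c j) \<le> (\<Sum>j\<in>{..<n - 1} - {i}. 1)"
        using c_le by (intro sum_mono) auto
      also have "\<dots> = real n - 2"
        using that \<open>n \<ge> 3\<close> by simp
      finally show ?thesis
        using assms(2) by simp
    qed
    show ?R
    proof (intro allI impI conjI)
      fix i assume i: "i < n - 1"
      have "(rise n r x i)\<^sup>2 \<le> 1\<^sup>2"
        using unit[rule_format, OF i] zero_le_power2[of "c i"] unfolding power_one by linarith
      then show "\<bar>rise n r x i\<bar> \<le> 1"
        by (simp add: abs_square_le_1)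
      have "1 - (rise n r x i)\<^sup>2 = (c i)\<^sup>2"
        using unit[rule_format, OF i] by simp
      then show "c i = sqrt (1 - (rise n r x i)\<^sup>2)"
        using c_nonneg[OF i] by simp
    qed
  next
    assume ?R
    \<comment> \<open>The bound on \<open>rise\<close> is essential: for a negative radicand,
      \<open>sqrt\<close> squares to minus the radicand, and the edge would not have length
      1.\<close>
    then show ?L
      by (auto simp: abs_square_le_1)
  qed
  ultimately show ?thesis
    unfolding c_def by (simp add: polygon_configs_alt)
qed

text \<open>Vertex \<open>j\<close> takes entry \<open>j - 1\<close>: vectors of \<^term>\<open>nsphere k\<close> are indexed from \<open>0\<close>.\<close>

definition height :: "nat \<Rightarrow> (nat \<Rightarrow> real) \<Rightarrow> nat \<Rightarrow> real" where
  "height n v j = (if j = 0 \<or> j = n - 1 then 0 else v (j - 1))"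

definition slope :: "nat \<Rightarrow> (nat \<Rightarrow> real) \<Rightarrow> nat \<Rightarrow> real" where
  "slope n v i = height n v (Suc i) - height n v i"

text \<open>Candidate preimage of v, with heights on the ray through v. Vertex n - 1 is not stored:
  it is fixed at \<open>(r, 0)\<close>, so closing up requires the sum over all n - 1 edges to be
  r.\<close>

definition config_of_heights :: "nat \<Rightarrow> (nat \<Rightarrow> real) \<Rightarrow> real \<Rightarrow> nat \<Rightarrow> real \<times> real" where
  "config_of_heights n v t =
     (\<lambda>j\<in>{1..n - 2}. (\<Sum>i<j. sqrt (1 - (t * slope n v i)\<^sup>2), t * height n v j))"

definition height_norm :: "nat \<Rightarrow> (nat \<Rightarrow> real \<times> real) \<Rightarrow> real" where
  "height_norm n x = sqrt (\<Sum>i\<le>n - 3. (snd (x (Suc i)))\<^sup>2)"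

text \<open>This is the homeomorphism. Entries past n - 3 are 0, as membership in
  \<open>nsphere\<close> demands.\<close>

definition direction :: "nat \<Rightarrow> (nat \<Rightarrow> real \<times> real) \<Rightarrow> nat \<Rightarrow> real" where
  "direction n x i = (if i \<le> n - 3 then snd (x (Suc i)) / height_norm n x else 0)"

lemma vertex_config_of_heights:
  assumes "(\<Sum>i<n - 1. sqrt (1 - (t * slope n v i)\<^sup>2)) = r" and "j \<le> n - 1"
  shows "vertex n r (config_of_heights n v t) j =
    (\<Sum>i<j. sqrt (1 - (t * slope n v i)\<^sup>2), t * height n v j)"
  using assms by (auto simp: vertex_def config_of_heights_def height_def)

lemma config_of_heights_in_polygon_configs:
  assumes "n \<ge> 3" and "real n - 2 \<le> r"
    and sum: "(\<Sum>i<n - 1. sqrt (1 - (t * slope n v i)\<^sup>2)) = r"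
    and le: "\<And>i. i < n - 1 \<Longrightarrow> \<bar>t * slope n v i\<bar> \<le> 1"
  shows "config_of_heights n v t \<in> polygon_configs n r"
proof -
  let ?x = "config_of_heights n v t"
  have "rise n r ?x i = t * slope n v i" if "i < n - 1" for i
    using that by (simp add: rise_def vertex_config_of_heights[OF sum] slope_def right_diff_distrib)
  moreover have "fst (vertex n r ?x (Suc i)) - fst (vertex n r ?x i) = sqrt (1 - (t * slope n v i)\<^sup>2)"
    if "i < n - 1" for i
    using that by (simp add: vertex_config_of_heights[OF sum])
  moreover have "?x \<in> {1..n - 2} \<rightarrow>\<^sub>E UNIV"
    by (simp add: config_of_heights_def)
  ultimately show ?thesis
    using le by (simp add: polygon_configs_iff_rise[OF assms(1,2)])
qed

text \<open>The heights fix the rises, hence the first coordinates as partial sums of nonnegative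
  roots; the last partial sum gives the closing equation.\<close>

lemma polygon_config_eq_config_of_heights:
  assumes "n \<ge> 3" and "real n - 2 \<le> r" and x: "x \<in> polygon_configs n r"
    and h: "\<And>j. j \<le> n - 1 \<Longrightarrow> snd (vertex n r x j) = t * height n v j"
  shows "(\<Sum>i<n - 1. sqrt (1 - (t * slope n v i)\<^sup>2)) = r" and "x = config_of_heights n v t"
proof -
  have "rise n r x i = t * slope n v i" if "i < n - 1" for i
    using that by (simp add: rise_def h slope_def right_diff_distrib)
  then have "fst (vertex n r x (Suc i)) - fst (vertex n r x i) = sqrt (1 - (t * slope n v i)\<^sup>2)"
    if "i < n - 1" for i
    using x that by (simp add: polygon_configs_iff_rise[OF assms(1,2)])
  then have fst: "fst (vertex n r x j) = (\<Sum>i<j. sqrt (1 - (t * slope n v i)\<^sup>2))" if "j \<le> n - 1" for j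
    using that by (simp flip: vertex_telescope[of j n r x])
  from fst[of "n - 1"] show "(\<Sum>i<n - 1. sqrt (1 - (t * slope n v i)\<^sup>2)) = r"
    using \<open>n \<ge> 3\<close> by (simp add: vertex_def)
  show "x = config_of_heights n v t"
  proof (rule extensionalityI[of _ "{1..n - 2}"])
    show "x \<in> extensional {1..n - 2}"
      using x by (simp add: polygon_configs_def PiE_def)
    show "config_of_heights n v t \<in> extensional {1..n - 2}"
      by (simp add: config_of_heights_def)
    fix j assume j: "j \<in> {1..n - 2}"
    then have "vertex n r x j = x j" and "j \<le> n - 1"
      by (auto simp: vertex_def)
    then show "x j = config_of_heights n v t j"
      using j fst[of j] h[of j] by (simp add: config_of_heights_def prod_eq_iff)
  qed
qed

lemma height_norm_pos:
  assumes "n \<ge> 3" and "real n - 2 \<le> r" and "r < real n - 1" and x: "x \<in> polygon_configs n r"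
  shows "height_norm n x > 0"
proof (rule ccontr)
  assume "\<not> height_norm n x > 0"
  then have "(\<Sum>i\<le>n - 3. (snd (x (Suc i)))\<^sup>2) = 0"
    by (simp add: height_norm_def sum_nonneg antisym not_less)
  then have zero: "\<forall>i\<le>n - 3. snd (x (Suc i)) = 0"
    by (simp add: sum_nonneg_eq_0_iff)
  \<comment> \<open>A flat polygon lies on the ray of any vector, with scale 0; its closing equation
    then reads n - 1 = r.\<close>
  have "snd (vertex n r x j) = 0 * height n (\<lambda>_. 0) j" if "j \<le> n - 1" for j
    using that zero[rule_format, of "j - 1"] by (auto simp: vertex_def)
  then have "(\<Sum>i<n - 1. sqrt (1 - (0 * slope n (\<lambda>_. 0) i)\<^sup>2)) = r"
    by (rule polygon_config_eq_config_of_heights(1)[OF assms(1,2) x])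
  then show False
    using assms(1,3) by simp
qed

section \<open>Bijectivity of the normalization of heights\<close>

lemma snd_vertex_eq_direction:
  assumes "height_norm n x > 0" and "j \<le> n - 1"
  shows "snd (vertex n r x j) = height_norm n x * height n (direction n x) j"
proof (cases "j = 0 \<or> j = n - 1")
  case False
  then show ?thesis
    using assms by (auto simp: vertex_def height_def direction_def)
qed (auto simp: vertex_def height_def)

lemma direction_in_nsphere:
  assumes "height_norm n x > 0"
  shows "direction n x \<in> topspace (nsphere (n - 3))"
proof -
  have "(\<Sum>i\<le>n - 3. (direction n x i)\<^sup>2) = (\<Sum>i\<le>n - 3. (snd (x (Suc i)))\<^sup>2) / (height_norm n x)\<^sup>2"
    by (simp add: direction_def power_divide sum_divide_distrib)
  also have "(\<Sum>i\<le>n - 3. (snd (x (Suc i)))\<^sup>2) = (height_norm n x)\<^sup>2"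
    by (simp add: height_norm_def sum_nonneg)
  finally show ?thesis
    using assms by (simp add: nsphere direction_def)
qed

text \<open>Heights start at 0, so vanishing slopes would force v = 0, against its unit
  norm.\<close>

lemma ex_nonzero_slope:
  assumes "n \<ge> 3" and v: "v \<in> topspace (nsphere (n - 3))"
  shows "\<exists>i\<in>{..<n - 1}. slope n v i \<noteq> 0"
proof (rule ccontr)
  assume "\<not> ?thesis"
  then have "height n v j = 0" if "j \<le> n - 1" for j
    using that vanishes_if_differences_vanish[of "height n v" "n - 1" j]
    by (auto simp: slope_def height_def[of n v 0])
  then have "height n v (Suc i) = 0" if "i \<le> n - 3" for i
    using that \<open>n \<ge> 3\<close> by simp
  moreover have "height n v (Suc i) = v i" if "i \<le> n - 3" for i
    using that \<open>n \<ge> 3\<close> by (auto simp: height_def)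
  ultimately show False
    using v by (simp add: nsphere)
qed

lemma direction_config_of_heights:
  assumes "n \<ge> 3" and v: "v \<in> topspace (nsphere (n - 3))" and "t > 0"
  shows "direction n (config_of_heights n v t) = v"
proof -
  have snd: "snd (config_of_heights n v t (Suc i)) = t * v i" if "i \<le> n - 3" for i
    using that \<open>n \<ge> 3\<close> by (auto simp: config_of_heights_def height_def)
  then have "height_norm n (config_of_heights n v t) = sqrt (t\<^sup>2 * (\<Sum>i\<le>n - 3. (v i)\<^sup>2))"
    by (simp add: height_norm_def power_mult_distrib sum_distrib_left)
  also have "\<dots> = t"
    using v \<open>t > 0\<close> by (simp add: nsphere)
  finally show ?thesis
    using snd v \<open>t > 0\<close> by (auto simp: direction_def nsphere fun_eq_iff)
qed

text \<open>Polygons with the same direction have heights on one ray, and both norms solve the same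
  closing equation, which is strictly monotone in the scale.\<close>

lemma inj_on_direction:
  assumes "n \<ge> 3" and "real n - 2 \<le> r" and "r < real n - 1"
  shows "inj_on (direction n) (polygon_configs n r)"
proof (rule inj_onI)
  fix x y assume x: "x \<in> polygon_configs n r" and y: "y \<in> polygon_configs n r"
    and eq: "direction n x = direction n y"
  define v where "v = direction n x"
  let ?g = "\<lambda>t. \<Sum>i<n - 1. sqrt (1 - (t * slope n v i)\<^sup>2)"
  note pos = height_norm_pos[OF assms x] height_norm_pos[OF assms y]
  have hx: "snd (vertex n r x j) = height_norm n x * height n v j"
    and hy: "snd (vertex n r y j) = height_norm n y * height n v j" if "j \<le> n - 1" for j
    using snd_vertex_eq_direction[OF pos(1) that] snd_vertex_eq_direction[OF pos(2) that] eq
    by (simp_all add: v_def)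
  have "?g (height_norm n x) = ?g (height_norm n y)"
    using polygon_config_eq_config_of_heights(1)[OF assms(1,2) x hx]
      polygon_config_eq_config_of_heights(1)[OF assms(1,2) y hy] by simp
  moreover have "\<exists>i\<in>{..<n - 1}. slope n v i \<noteq> 0"
    unfolding v_def by (intro ex_nonzero_slope direction_in_nsphere assms pos)
  then have "?g u < ?g t" if "0 < t" "t < u" for t u
    using that by (intro sum_sqrt_strict_decreasing) auto
  ultimately have "height_norm n x = height_norm n y"
    using pos by (metis less_irrefl linorder_less_linear)
  then show "x = y"
    using polygon_config_eq_config_of_heights(2)[OF assms(1,2) x hx]
      polygon_config_eq_config_of_heights(2)[OF assms(1,2) y hy] by simp
qed

lemma direction_image:
  assumes "n \<ge> 3" and "real n - 2 \<le> r" and "r < real n - 1"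
  shows "direction n ` polygon_configs n r = topspace (nsphere (n - 3))"
proof (intro equalityI subsetI)
  fix v assume v: "v \<in> topspace (nsphere (n - 3))"
  obtain t where t: "t \<ge> 0" "\<And>i. i \<in> {..<n - 1} \<Longrightarrow> \<bar>t * slope n v i\<bar> \<le> 1"
    "(\<Sum>i<n - 1. sqrt (1 - (t * slope n v i)\<^sup>2)) = r"
  proof (rule sum_sqrt_attains[OF finite_lessThan ex_nonzero_slope[OF assms(1) v]])
    show "real (card {..<n - 1}) - 1 \<le> r" and "r \<le> real (card {..<n - 1})"
      using assms by auto
  qed (rule that)
  \<comment> \<open>At t = 0 the sum is n - 1 > r.\<close>
  have "t \<noteq> 0"
    using t(3) assms by auto
  then have "direction n (config_of_heights n v t) = v"
    using assms(1) v t(1) by (intro direction_config_of_heights) auto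
  moreover have "config_of_heights n v t \<in> polygon_configs n r"
    using config_of_heights_in_polygon_configs[OF assms(1,2) t(3)] t(2) by simp
  ultimately show "v \<in> direction n ` polygon_configs n r"
    by (metis imageI)
qed (use height_norm_pos[OF assms] direction_in_nsphere in auto)

section \<open>Topology of the polygon space\<close>

lemma continuous_map_vertex:
  assumes "i \<le> n - 1"
  shows "continuous_map (product_topology (\<lambda>_. euclidean) {1..n - 2}) euclidean (\<lambda>x. vertex n r x i)"
proof (cases "i = 0 \<or> i = n - 1")
  case True
  then show ?thesis
    by (auto simp: vertex_def)
next
  case False
  then have "i \<in> {1..n - 2}"
    using assms by auto
  from continuous_map_product_projection[OF this, of "\<lambda>_. euclidean"] False show ?thesis
    by (simp add: vertex_def)
qed

text \<open>The triangle inequality along the unit edges; it supplies the boundedness needed for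
  compactness.\<close>

lemma dist_vertex_0_le:
  assumes "x \<in> polygon_configs n r" and "j \<le> n - 1"
  shows "dist 0 (vertex n r x j) \<le> real j"
  using assms(2)
proof (induction j)
  case 0
  then show ?case
    by (simp add: vertex_def flip: zero_prod_def)
next
  case (Suc j)
  then have "dist (vertex n r x j) (vertex n r x (Suc j)) = 1"
    using assms(1) by (simp add: polygon_configs_alt)
  then show ?case
    using Suc dist_triangle[of 0 "vertex n r x (Suc j)" "vertex n r x j"] by simp
qed

lemma compact_polygon_space: "compact_space (polygon_space n r)"
proof -
  let ?P = "product_topology (\<lambda>_. euclidean :: (real \<times> real) topology) {1..n - 2}"
  let ?S = "\<lambda>i. {x \<in> topspace ?P. dist (vertex n r x i) (vertex n r x (Suc i)) \<in> {1}}"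
  have "closedin ?P (?S i)" if "i < n - 1" for i
  proof (rule closedin_continuous_map_preimage)
    show "continuous_map ?P euclideanreal (\<lambda>x. dist (vertex n r x i) (vertex n r x (Suc i)))"
      using continuous_map_vertex[of i n r] continuous_map_vertex[of "Suc i" n r] that
      by (simp add: continuous_map_atin tendsto_dist)
  qed simp
  \<comment> \<open>Inserting the whole space keeps the family nonempty for every n and makes the
    intersection consist of extensional functions.\<close>
  then have "closedin ?P (\<Inter>(insert (topspace ?P) (?S ` {..<n - 1})))"
    by (intro closedin_Inter) (use closedin_topspace[of ?P] in blast)+
  moreover have "\<Inter>(insert (topspace ?P) (?S ` {..<n - 1})) = polygon_configs n r"
    by (auto simp: polygon_configs_alt)
  ultimately have "closedin ?P (polygon_configs n r)"
    by simp
  moreover have "compactin ?P ({1..n - 2} \<rightarrow>\<^sub>E cball 0 (real n))"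
    by (simp add: compactin_PiE)
  moreover have "polygon_configs n r \<subseteq> {1..n - 2} \<rightarrow>\<^sub>E cball 0 (real n)"
  proof
    fix x assume x: "x \<in> polygon_configs n r"
    have "x j \<in> cball 0 (real n)" if "j \<in> {1..n - 2}" for j
    proof -
      have "vertex n r x j = x j" "j \<le> n - 1"
        using that by (auto simp: vertex_def)
      then show ?thesis
        using dist_vertex_0_le[OF x, of j] by simp
    qed
    then show "x \<in> {1..n - 2} \<rightarrow>\<^sub>E cball 0 (real n)"
      using x by (auto simp: polygon_configs_def PiE_def)
  qed
  ultimately have "compactin ?P (polygon_configs n r)"
    using closed_compactin by blast
  then show ?thesis
    by (simp add: polygon_space_def compact_space_subtopology)
qed

lemma continuous_map_direction:
  assumes "n \<ge> 3" and "real n - 2 \<le> r" and "r < real n - 1"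
  shows "continuous_map (polygon_space n r) (nsphere (n - 3)) (direction n)"
proof -
  let ?X = "polygon_space n r"
  have snd: "continuous_map ?X euclideanreal (\<lambda>x. snd (x (Suc i)))" if "i \<le> n - 3" for i
  proof -
    have "continuous_map ?X euclidean (\<lambda>x. x (Suc i))"
      unfolding polygon_space_def using that \<open>n \<ge> 3\<close>
      by (intro continuous_map_from_subtopology continuous_map_product_projection) auto
    then show ?thesis
      by (simp add: continuous_map_atin tendsto_snd)
  qed
  have "continuous_map ?X euclideanreal (height_norm n)"
    unfolding height_norm_def using snd by (intro continuous_intros) auto
  moreover have "height_norm n x \<noteq> 0" if "x \<in> topspace ?X" for x
    using height_norm_pos[OF assms] that by (force simp: topspace_polygon_space)
  ultimately have "continuous_map ?X euclideanreal (\<lambda>x. direction n x i)" for i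
    \<comment> \<open>Coordinates up to n - 3 are quotients with nonvanishing denominator; the rest
      are constantly 0.\<close>
    using snd by (cases "i \<le> n - 3") (simp_all add: direction_def continuous_map_real_divide)
  moreover have "direction n x \<in> topspace (nsphere (n - 3))" if "x \<in> topspace ?X" for x
    using direction_image[OF assms] that by (auto simp: topspace_polygon_space)
  ultimately show ?thesis
    by (auto simp: nsphere continuous_map_in_subtopology continuous_map_componentwise_UNIV)
qed

lemma Hausdorff_space_nsphere: "Hausdorff_space (nsphere k)"
  by (simp add: nsphere Hausdorff_space_subtopology Hausdorff_space_product_topology)

section \<open>Equivariance and the homeomorphism\<close>

lemma direction_reflect_config:
  assumes "n \<ge> 3"
  shows "direction n (reflect_config n x) = antipode (direction n x)"
proof -
  have "snd (reflect_config n x (Suc i)) = - snd (x (Suc i))" if "i \<le> n - 3" for i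
    using that assms by (auto simp: reflect_config_def reflect_x_def)
  \<comment> \<open>The squares in \<open>height_norm\<close> absorb the signs, so only the
    numerators change.\<close>
  then show ?thesis
    by (simp add: direction_def height_norm_def antipode_def fun_eq_iff)
qed

theorem theorem1p2:
  fixes n :: nat and r :: real
  assumes "n \<ge> 3" and "real n - 2 \<le> r" and "r < real n - 1"
  shows "\<exists>\<Phi>. homeomorphic_map (polygon_space n r) (nsphere (n - 3)) \<Phi> \<and>
    (\<forall>x\<in>topspace (polygon_space n r). \<Phi> (reflect_config n x) = antipode (\<Phi> x))"
proof (intro exI conjI ballI)
  show "homeomorphic_map (polygon_space n r) (nsphere (n - 3)) (direction n)"
    \<comment> \<open>A continuous bijection from a compact space onto a Hausdorff space has a
      continuous inverse.\<close>
    by (intro continuous_imp_homeomorphic_map continuous_map_direction compact_polygon_space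
        Hausdorff_space_nsphere assms)
      (simp_all add: topspace_polygon_space direction_image inj_on_direction assms)
qed (rule direction_reflect_config[OF assms(1)])

end
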